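(* Every cancellative one-sided amenable monoid is surjunctive; that is, every cancellative monoid that is left-amenable or right-amenable is surjunctive.
   Context: For a monoid $M$ and $m\in M$, let $L_m, R_m\colon M\to M$ be $L_m(m')=mm'$ and $R_m(m')=m'm$. The monoid $M$ is cancellative if $L_m$ and $R_m$ are injective for every $m\in M$. Let $\ell^\infty(M)$ be the real vector space of bounded functions $f\colon M\to\mathbb{R}$. A mean on $M$ is an $\mathbb{R}$-linear map $\mu\colon \ell^\infty(M)\to\mathbb{R}$ with $\inf_{m\in M} f(m)\le \mu(f)\le \sup_{m\in M} f(m)$ for all $f\in\ell^\infty(M)$. The mean $\mu$ is left-invariant (resp. right-invariant) if $\mu(f\circ L_m)=\mu(f)$ (resp. $\mu(f\circ R_m)=\mu(f)$) for all $f\in\ell^\infty(M)$ and $m\in M$. The monoid $M$ is left-amenable (resp. right-amenable) if it admits a left-invariant (resp. right-invariant) mean. Let $M$ be a monoid and $A$ a set. The set $A^M$ of all maps $x\colon M\to A$ carries the shift action of $M$ given by $(mx)(m') := x(m'm)$ for $m,m'\in M$, and the prodiscrete uniform structure, for which a base of entourages is given by the sets $W_F := \{(x,y)\in A^M\times A^M : x|_F = y|_F\}$, $F$ running over all finite subsets of $M$. A cellular automaton over $M$ with alphabet $A$ is a map $\tau\colon A^M\to A^M$ that is $M$-equivariant ($\tau(mx)=m\tau(x)$ for all $m\in M$, $x\in A^M$) and uniformly continuous. The monoid $M$ is called surjunctive if, for every finite set $A$, every injective cellular automaton $\tau\colon A^M\to A^M$ is surjective. *)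

theory Defs
  imports "HOL-Analysis.Analysis" "HOL-Algebra.Divisibility"
begin

definition left_mult :: "('m, 'k) monoid_scheme \<Rightarrow> 'm \<Rightarrow> 'm \<Rightarrow> 'm" where
  "left_mult M m = (\<lambda>m'\<in>carrier M. m \<otimes>\<^bsub>M\<^esub> m')"

definition right_mult :: "('m, 'k) monoid_scheme \<Rightarrow> 'm \<Rightarrow> 'm \<Rightarrow> 'm" where
  "right_mult M m = (\<lambda>m'\<in>carrier M. m' \<otimes>\<^bsub>M\<^esub> m)"

text \<open>Cancellativity is the library locale \<^locale>\<open>monoid_cancel\<close>.\<close>

lemma monoid_cancel_iff_inj_mult:
  fixes M :: "('m, 'k) monoid_scheme"
  shows "monoid_cancel M \<longleftrightarrow> monoid M \<and>
    (\<forall>m\<in>carrier M. inj_on (left_mult M m) (carrier M) \<and> inj_on (right_mult M m) (carrier M))"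
proof -
  have "monoid_cancel_axioms M \<longleftrightarrow>
    (\<forall>m\<in>carrier M. inj_on (left_mult M m) (carrier M) \<and> inj_on (right_mult M m) (carrier M))"
    unfolding monoid_cancel_axioms_def inj_on_def left_mult_def right_mult_def
    by (simp add: restrict_def) blast
  then show ?thesis by (simp add: monoid_cancel_def)
qed

text \<open>Functions on the carrier are represented by total functions that take the value
  \<^const>\<open>undefined\<close> outside it, so that equality of functions on the carrier is HOL
  equality. The vector space operations below are therefore restricted to the carrier.\<close>

definition ell_infinity :: "('m, 'k) monoid_scheme \<Rightarrow> ('m \<Rightarrow> real) set" where
  "ell_infinity M = {f \<in> extensional (carrier M). bounded (f ` carrier M)}"

definition is_mean :: "('m, 'k) monoid_scheme \<Rightarrow> (('m \<Rightarrow> real) \<Rightarrow> real) \<Rightarrow> bool" where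
  "is_mean M \<mu> \<longleftrightarrow>
    (\<forall>f\<in>ell_infinity M. \<forall>g\<in>ell_infinity M. \<mu> (\<lambda>m\<in>carrier M. f m + g m) = \<mu> f + \<mu> g) \<and>
    (\<forall>c. \<forall>f\<in>ell_infinity M. \<mu> (\<lambda>m\<in>carrier M. c * f m) = c * \<mu> f) \<and>
    (\<forall>f\<in>ell_infinity M. (INF m\<in>carrier M. f m) \<le> \<mu> f \<and> \<mu> f \<le> (SUP m\<in>carrier M. f m))"

definition left_invariant_mean :: "('m, 'k) monoid_scheme \<Rightarrow> (('m \<Rightarrow> real) \<Rightarrow> real) \<Rightarrow> bool" where
  "left_invariant_mean M \<mu> \<longleftrightarrow> is_mean M \<mu> \<and>
    (\<forall>f\<in>ell_infinity M. \<forall>m\<in>carrier M. \<mu> (compose (carrier M) f (left_mult M m)) = \<mu> f)"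

definition right_invariant_mean :: "('m, 'k) monoid_scheme \<Rightarrow> (('m \<Rightarrow> real) \<Rightarrow> real) \<Rightarrow> bool" where
  "right_invariant_mean M \<mu> \<longleftrightarrow> is_mean M \<mu> \<and>
    (\<forall>f\<in>ell_infinity M. \<forall>m\<in>carrier M. \<mu> (compose (carrier M) f (right_mult M m)) = \<mu> f)"

definition left_amenable :: "('m, 'k) monoid_scheme \<Rightarrow> bool" where
  "left_amenable M \<longleftrightarrow> (\<exists>\<mu>. left_invariant_mean M \<mu>)"

definition right_amenable :: "('m, 'k) monoid_scheme \<Rightarrow> bool" where
  "right_amenable M \<longleftrightarrow> (\<exists>\<mu>. right_invariant_mean M \<mu>)"

definition configurations :: "('m, 'k) monoid_scheme \<Rightarrow> 'a set \<Rightarrow> ('m \<Rightarrow> 'a) set" where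
  "configurations M A = (carrier M \<rightarrow>\<^sub>E A)"

definition shift :: "('m, 'k) monoid_scheme \<Rightarrow> 'm \<Rightarrow> ('m \<Rightarrow> 'a) \<Rightarrow> ('m \<Rightarrow> 'a)" where
  "shift M m x = (\<lambda>m'\<in>carrier M. x (m' \<otimes>\<^bsub>M\<^esub> m))"

definition agree_on :: "('m, 'k) monoid_scheme \<Rightarrow> 'a set \<Rightarrow> 'm set \<Rightarrow> (('m \<Rightarrow> 'a) \<times> ('m \<Rightarrow> 'a)) set" where
  "agree_on M A F =
    {(x, y) \<in> configurations M A \<times> configurations M A. restrict x F = restrict y F}"

text \<open>As for the library class \<^class>\<open>uniform_space\<close>, a uniform structure is given by the
  filter of its entourages. The class itself does not apply, since the configurations form
  a set and not a type.\<close>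

definition prodiscrete_uniformity ::
    "('m, 'k) monoid_scheme \<Rightarrow> 'a set \<Rightarrow> (('m \<Rightarrow> 'a) \<times> ('m \<Rightarrow> 'a)) filter" where
  "prodiscrete_uniformity M A =
    (INF F\<in>{F. finite F \<and> F \<subseteq> carrier M}. principal (agree_on M A F))"

lemma eventually_prodiscrete_uniformity:
  fixes M :: "('m, 'k) monoid_scheme" and A :: "'a set"
  shows "eventually P (prodiscrete_uniformity M A) \<longleftrightarrow>
    (\<exists>F. finite F \<and> F \<subseteq> carrier M \<and> (\<forall>p\<in>agree_on M A F. P p))"
proof -
  have mono: "agree_on M A G \<subseteq> agree_on M A F" if "F \<subseteq> G" for F G
  proof -
    have "restrict x F = restrict y F" if "restrict x G = restrict y G" for x y :: "'m \<Rightarrow> 'a"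
    proof (rule restrict_ext)
      fix m assume "m \<in> F"
      then have "m \<in> G" using \<open>F \<subseteq> G\<close> by blast
      then show "x m = y m" using fun_cong[OF that, of m] by simp
    qed
    then show ?thesis unfolding agree_on_def by blast
  qed
  show ?thesis
    unfolding prodiscrete_uniformity_def
  proof (subst eventually_INF_base)
    show "{F. finite F \<and> F \<subseteq> carrier M} \<noteq> {}" by blast
  next
    fix F G
    assume F: "F \<in> {F. finite F \<and> F \<subseteq> carrier M}" and G: "G \<in> {F. finite F \<and> F \<subseteq> carrier M}"
    have "principal (agree_on M A (F \<union> G))
        \<le> inf (principal (agree_on M A F)) (principal (agree_on M A G))"
      using mono[of F "F \<union> G"] mono[of G "F \<union> G"] by simp
    moreover have "F \<union> G \<in> {F. finite F \<and> F \<subseteq> carrier M}" using F G by blast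
    ultimately show "\<exists>H\<in>{F. finite F \<and> F \<subseteq> carrier M}.
        principal (agree_on M A H) \<le> inf (principal (agree_on M A F)) (principal (agree_on M A G))"
      by blast
  next
    show "(\<exists>F\<in>{F. finite F \<and> F \<subseteq> carrier M}. eventually P (principal (agree_on M A F))) \<longleftrightarrow>
        (\<exists>F. finite F \<and> F \<subseteq> carrier M \<and> (\<forall>p\<in>agree_on M A F. P p))"
      unfolding eventually_principal by blast
  qed
qed

definition cellular_automaton ::
    "('m, 'k) monoid_scheme \<Rightarrow> 'a set \<Rightarrow> (('m \<Rightarrow> 'a) \<Rightarrow> ('m \<Rightarrow> 'a)) \<Rightarrow> bool" where
  "cellular_automaton M A \<tau> \<longleftrightarrow>
    \<tau> \<in> configurations M A \<rightarrow> configurations M A \<and>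
    (\<forall>m\<in>carrier M. \<forall>x\<in>configurations M A. \<tau> (shift M m x) = shift M m (\<tau> x)) \<and>
    filterlim (\<lambda>(x, y). (\<tau> x, \<tau> y)) (prodiscrete_uniformity M A) (prodiscrete_uniformity M A)"

text \<open>HOL cannot quantify over types inside a definition, so the type from which the finite
  alphabets are taken is a parameter. A statement with \<^typ>\<open>'a\<close> left as a type variable
  covers all finite alphabets.\<close>

definition surjunctive :: "'a itself \<Rightarrow> ('m, 'k) monoid_scheme \<Rightarrow> bool" where
  "surjunctive _ M \<longleftrightarrow>
    (\<forall>(A :: 'a set) \<tau>. finite A \<longrightarrow> cellular_automaton M A \<tau> \<longrightarrow>
      inj_on \<tau> (configurations M A) \<longrightarrow> \<tau> ` configurations M A = configurations M A)"

end

(* If an injective automaton misses some configuration, then by compactness it misses a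
   pattern on a finite set, and its inverse has finite memory. Folner sets, obtained from the
   invariant mean through Hall's theorem, carry finite models of left multiplication in the
   left amenable case and of right division in the right amenable case. On such a model the
   induced automaton is injective up to boundary effects, yet its images avoid a fixed
   pattern at a positive proportion of the places; comparing the number of images from both
   sides gives a contradiction. *)
theory Submission imports Defs begin

section \<open>Compactness and Hall's theorem\<close>

text \<open>Since \<open>shift M k x\<close> reads \<open>x\<close> at
  \<open>m' \<otimes> k\<close>, equivariance makes \<open>\<tau> x k\<close> the local rule at the
  identity applied to the letters of \<open>x\<close> at \<open>j \<otimes> k\<close>, with
  \<open>j\<close> in the memory set. The memory spreads by left multiplication, so a finite model
  has to carry something like a left action. Left multiplications on a left Folner set do so
  directly. Right multiplications compose in the opposite order; only their inverses form a left
  action, and in a monoid these are partial maps. Hence the automaton is transplanted to a set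
  \<open>\<Omega>\<close> whose maps are controlled only on a core \<open>E\<close>, and cells
  outside \<open>\<Omega>\<close> are filled with a fixed letter. One cancellation law makes the
  multiplications injective, which turns invariance of the mean under preimages into invariance
  under images; the other makes \<open>\<phi> k w\<close> differ for different \<open>k\<close>, so
  that a pattern of \<open>M\<close> fits into the model. The two laws exchange roles between the
  left and the right case.\<close>

text \<open>By Tychonoff: a predicate reading finitely many coordinates cuts a closed set out of the
  product of the finite discrete spaces \<open>B i\<close>. This serves Hall's theorem on infinite
  index sets, the memory of the inverse and the missed pattern.\<close>

lemma local_predicates_compact:
  fixes B :: "'i \<Rightarrow> 'b set" and P :: "'t \<Rightarrow> ('i \<Rightarrow> 'b) \<Rightarrow> bool"
  assumes fin: "\<And>i. i \<in> I \<Longrightarrow> finite (B i)"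
    and loc: "\<And>t. t \<in> T \<Longrightarrow> \<exists>J. finite J \<and> J \<subseteq> I \<and>
      (\<forall>x\<in>Pi\<^sub>E I B. \<forall>y\<in>Pi\<^sub>E I B. (\<forall>j\<in>J. x j = y j) \<longrightarrow> P t x \<longrightarrow> P t y)"
    and fip: "\<And>S. finite S \<Longrightarrow> S \<subseteq> T \<Longrightarrow> \<exists>x\<in>Pi\<^sub>E I B. \<forall>t\<in>S. P t x"
  shows "\<exists>x\<in>Pi\<^sub>E I B. \<forall>t\<in>T. P t x"
proof -
  define X where "X = product_topology (\<lambda>i. discrete_topology (B i)) I"
  have top: "topspace X = Pi\<^sub>E I B"
    by (simp add: X_def)
  have comp: "compact_space X"
    unfolding X_def compact_space_product_topology using fin by (simp add: compact_space_discrete_topology)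
  define C where "C t = {x \<in> Pi\<^sub>E I B. P t x}" for t
  have closed: "closedin X (C t)" if t: "t \<in> T" for t
  proof -
    obtain J where J: "finite J" "J \<subseteq> I"
      and PJ: "\<forall>x\<in>Pi\<^sub>E I B. \<forall>y\<in>Pi\<^sub>E I B. (\<forall>j\<in>J. x j = y j) \<longrightarrow> P t x \<longrightarrow> P t y"
      using loc[OF t] by blast
    have "openin X (topspace X - C t)"
    proof (subst openin_subopen, intro ballI)
      fix x assume x: "x \<in> topspace X - C t"
      define U where "U = Pi\<^sub>E I (\<lambda>i. if i \<in> J then {x i} else B i)"
      have xB: "x \<in> Pi\<^sub>E I B" "\<not> P t x"
        using x by (auto simp: top C_def)
      have "openin X U"
        unfolding U_def X_def
      proof (rule product_topology_basis)
        show "openin (discrete_topology (B i)) (if i \<in> J then {x i} else B i)" for i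
          using J(2) xB by (auto simp: PiE_iff)
      next
        have "{i. (if i \<in> J then {x i} else B i) \<noteq> topspace (discrete_topology (B i))} \<subseteq> J"
          by auto
        then show "finite {i. (if i \<in> J then {x i} else B i) \<noteq> topspace (discrete_topology (B i))}"
          using J finite_subset by blast
      qed
      moreover have "x \<in> U"
        using xB by (auto simp: U_def PiE_iff)
      moreover have "U \<subseteq> topspace X - C t"
      proof
        fix y assume y: "y \<in> U"
        have yB: "y \<in> Pi\<^sub>E I B"
          using y xB by (auto simp: U_def PiE_iff split: if_splits)
        have "\<forall>j\<in>J. y j = x j"
          using y J by (force simp: U_def PiE_iff split: if_splits)
        then show "y \<in> topspace X - C t"
          using PJ[rule_format, OF yB xB(1)] xB yB by (auto simp: top C_def)
      qed
      ultimately show "\<exists>V. openin X V \<and> x \<in> V \<and> V \<subseteq> topspace X - C t" by blast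
    qed
    then show ?thesis
      unfolding closedin_def by (auto simp: C_def top)
  qed
  have "topspace X \<inter> \<Inter> (C ` T) \<noteq> {}"
  \<comment> \<open>For empty \<open>T\<close> the intersection is the whole type, so a point of the
    product has to come from \<open>fip\<close>.\<close>
  proof (cases "T = {}")
    case True
    then show ?thesis using fip[of "{}"] top by auto
  next
    case False
    have closed': "\<forall>D\<in>C ` T. closedin X D"
      using closed by blast
    have fip': "\<Inter> \<F> \<noteq> {}" if \<F>: "finite \<F>" "\<F> \<subseteq> C ` T" for \<F>
    proof -
      obtain S where S: "S \<subseteq> T" "finite S" "\<F> = C ` S"
        using finite_subset_image[OF \<F>] by blast
      then obtain x where "x \<in> Pi\<^sub>E I B" "\<forall>t\<in>S. P t x"
        using fip by blast
      then have "x \<in> \<Inter> \<F>" by (simp add: S C_def)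
      then show ?thesis by blast
    qed
    have "\<Inter> (C ` T) \<noteq> {}"
      using comp[unfolded compact_space_fip] closed' fip' by blast
    then obtain x where x: "\<forall>t\<in>T. x \<in> C t" by blast
    then have "x \<in> topspace X" using False unfolding C_def top by blast
    then show ?thesis using x by blast
  qed
  then obtain x where x: "x \<in> topspace X" "\<forall>t\<in>T. x \<in> C t" by blast
  then have "\<forall>t\<in>T. P t x" unfolding C_def by blast
  then show ?thesis using x(1) top by blast
qed

text \<open>Rado's proof: while some set has two distinct elements, one of them can be deleted
  without destroying Hall's condition.\<close>

lemma hall_finite:
  fixes A :: "'i \<Rightarrow> 'b set"
  assumes "finite I" "\<And>i. i \<in> I \<Longrightarrow> finite (A i)"
    and "\<And>J. J \<subseteq> I \<Longrightarrow> card J \<le> card (\<Union> (A ` J))"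
  shows "\<exists>h. inj_on h I \<and> (\<forall>i\<in>I. h i \<in> A i)"
  using assms(2,3)
proof (induction "\<Sum>i\<in>I. card (A i)" arbitrary: A rule: less_induct)
  case less
  note fin = less.prems(1) and hall = less.prems(2)
  have ne: "A i \<noteq> {}" if "i \<in> I" for i
    using hall[of "{i}"] that by auto
  show ?case
  proof (cases "\<exists>i\<in>I. \<exists>x\<in>A i. \<exists>y\<in>A i. x \<noteq> y")
    case False
    define h where "h i = (SOME x. x \<in> A i)" for i
    have h: "A i = {h i}" if "i \<in> I" for i
    proof -
      have "h i \<in> A i" unfolding h_def using ne[OF that] by (simp add: some_in_eq)
      then show ?thesis using False that by blast
    qed
    have "inj_on h I"
    proof (rule inj_onI, rule ccontr)
      fix i j assume ij: "i \<in> I" "j \<in> I" "h i = h j" "i \<noteq> j"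
      then have "\<Union> (A ` {i, j}) = {h i}" using h by auto
      then show False using hall[of "{i, j}"] ij by simp
    qed
    then show ?thesis using h by auto
  next
    case True
    then obtain i x y where i: "i \<in> I" and xy: "x \<in> A i" "y \<in> A i" "x \<noteq> y" by blast
    \<comment> \<open>Deleting \<open>z\<close> affects Hall's condition only for sets containing
      \<open>i\<close>; for \<open>insert i J\<close> it asks for one more than
      \<open>card J\<close>, hence the strict inequality in \<open>hz\<close>.\<close>
    have step: ?thesis if z: "z \<in> A i"
      and hz: "\<And>J. J \<subseteq> I - {i} \<Longrightarrow> card J < card (\<Union> (A ` J) \<union> (A i - {z}))" for z
    proof -
      define A' where "A' = A(i := A i - {z})"
      have "\<exists>h. inj_on h I \<and> (\<forall>j\<in>I. h j \<in> A' j)"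
      proof (rule less.hyps)
        have "card (A i - {z}) < card (A i)"
          using z fin[OF i] by (intro psubset_card_mono) auto
        then show "(\<Sum>j\<in>I. card (A' j)) < (\<Sum>j\<in>I. card (A j))"
          by (intro sum_strict_mono_ex1) (use assms(1) i fin in \<open>auto simp: A'_def card_mono\<close>)
        show "finite (A' j)" if "j \<in> I" for j using fin that i by (auto simp: A'_def)
        show "card J \<le> card (\<Union> (A' ` J))" if J: "J \<subseteq> I" for J
        proof (cases "i \<in> J")
          case False
          then have "\<Union> (A' ` J) = \<Union> (A ` J)" by (auto simp: A'_def)
          then show ?thesis using hall J by simp
        next
          case True
          have "\<Union> (A' ` J) = \<Union> (A ` (J - {i})) \<union> (A i - {z})"
            using True by (auto simp: A'_def split: if_splits)
          moreover have "card J = Suc (card (J - {i}))"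
            using True J assms(1) by (metis card_Suc_Diff1 finite_subset)
          moreover have "card (J - {i}) < card (\<Union> (A ` (J - {i})) \<union> (A i - {z}))"
            using J by (intro hz) auto
          ultimately show ?thesis by simp
        qed
      qed
      then show ?thesis using z by (auto simp: A'_def split: if_splits)
    qed
    \<comment> \<open>Suppose \<open>J\<close> blocks the deletion of \<open>x\<close> and
      \<open>J'\<close> that of \<open>y\<close>. As \<open>x\<close> and \<open>y\<close> differ,
      \<open>?U \<union> ?V\<close> is the whole neighbourhood of
      \<open>insert i (J \<union> J')\<close>, while \<open>?U \<inter> ?V\<close> contains that of
      \<open>J \<inter> J'\<close>. Hall's condition for these two sets exceeds
      \<open>card J + card J'\<close> by one.\<close>
    have "(\<forall>J \<subseteq> I - {i}. card J < card (\<Union> (A ` J) \<union> (A i - {x}))) \<or>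
      (\<forall>J \<subseteq> I - {i}. card J < card (\<Union> (A ` J) \<union> (A i - {y})))"
    proof (rule ccontr)
      assume "\<not> ?thesis"
      then obtain J J' where J: "J \<subseteq> I - {i}" "card (\<Union> (A ` J) \<union> (A i - {x})) \<le> card J"
        and J': "J' \<subseteq> I - {i}" "card (\<Union> (A ` J') \<union> (A i - {y})) \<le> card J'"
        by (auto simp: not_less)
      let ?U = "\<Union> (A ` J) \<union> (A i - {x})" and ?V = "\<Union> (A ` J') \<union> (A i - {y})"
      have finJ: "finite J" "finite J'" using J J' assms(1) by (auto intro: finite_subset)
      have finU: "finite ?U" "finite ?V" using J J' fin i finJ by auto
      have "card ?U + card ?V = card (?U \<union> ?V) + card (?U \<inter> ?V)"
        using card_Un_Int[OF finU] .
      moreover have "card (?U \<union> ?V) = card (\<Union> (A ` (insert i (J \<union> J'))))"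
        using xy by (intro arg_cong[where f = card]) auto
      moreover have "card (insert i (J \<union> J')) \<le> card (\<Union> (A ` (insert i (J \<union> J'))))"
        using J J' i by (intro hall) auto
      moreover have "card (insert i (J \<union> J')) = Suc (card (J \<union> J'))"
        using J J' finJ by (intro card_insert_disjoint) auto
      moreover have "card (J \<inter> J') \<le> card (\<Union> (A ` (J \<inter> J')))"
        using J by (intro hall) auto
      moreover have "card (\<Union> (A ` (J \<inter> J'))) \<le> card (?U \<inter> ?V)"
        using finU by (intro card_mono) auto
      moreover have "card J + card J' = card (J \<union> J') + card (J \<inter> J')"
        using card_Un_Int[OF finJ] .
      ultimately show False using J J' by linarith
    qed
    then show ?thesis using step[OF xy(1)] step[OF xy(2)] by blast
  qed
qed

text \<open>Injectivity is a family of conditions on two coordinates each, so compactness extends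
  the finite case. The index set needed below consists of copies of the whole monoid.\<close>

lemma hall_locally_finite:
  fixes A :: "'i \<Rightarrow> 'b set"
  assumes fin: "\<And>i. i \<in> I \<Longrightarrow> finite (A i)"
    and hall: "\<And>J. finite J \<Longrightarrow> J \<subseteq> I \<Longrightarrow> card J \<le> card (\<Union> (A ` J))"
  obtains h where "inj_on h I" "\<And>i. i \<in> I \<Longrightarrow> h i \<in> A i"
proof -
  have ne: "A i \<noteq> {}" if "i \<in> I" for i
    using hall[of "{i}"] that by auto
  define N where "N t h \<longleftrightarrow> h (fst t) \<noteq> h (snd t)" for t and h :: "'i \<Rightarrow> 'b"
  define Q where "Q = {(i, j). i \<in> I \<and> j \<in> I \<and> i \<noteq> j}"
  have "\<exists>h\<in>Pi\<^sub>E I A. \<forall>t\<in>Q. N t h"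
  proof (rule local_predicates_compact)
    show "finite (A i)" if "i \<in> I" for i using fin that .
  next
    fix t assume "t \<in> Q"
    then show "\<exists>J. finite J \<and> J \<subseteq> I \<and>
      (\<forall>x\<in>Pi\<^sub>E I A. \<forall>y\<in>Pi\<^sub>E I A. (\<forall>j\<in>J. x j = y j) \<longrightarrow> N t x \<longrightarrow> N t y)"
      by (intro exI[of _ "{fst t, snd t}"]) (auto simp: N_def Q_def)
  next
    fix R assume R: "finite R" "R \<subseteq> Q"
    define J where "J = fst ` R \<union> snd ` R"
    have J: "finite J" "J \<subseteq> I" using R by (auto simp: J_def Q_def)
    obtain h where h: "inj_on h J" "\<And>i. i \<in> J \<Longrightarrow> h i \<in> A i"
    proof -
      have "\<exists>h. inj_on h J \<and> (\<forall>i\<in>J. h i \<in> A i)"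
      proof (rule hall_finite[OF J(1)])
        show "finite (A i)" if "i \<in> J" for i using fin J that by blast
        show "card J' \<le> card (\<Union> (A ` J'))" if "J' \<subseteq> J" for J'
          using J that by (intro hall) (auto intro: finite_subset)
      qed
      then show thesis using that by blast
    qed
    define g where "g = (\<lambda>i\<in>I. if i \<in> J then h i else (SOME b. b \<in> A i))"
    have "g \<in> Pi\<^sub>E I A" using h ne by (auto simp: g_def some_in_eq)
    moreover have "N t g" if t: "t \<in> R" for t
    proof -
      have "fst t \<in> J" "snd t \<in> J"
        using t by (simp_all add: J_def)
      moreover have "fst t \<noteq> snd t" using t R by (auto simp: Q_def)
      ultimately show ?thesis
        using J h(1) by (auto simp: N_def g_def inj_on_def)
    qed
    ultimately show "\<exists>x\<in>Pi\<^sub>E I A. \<forall>t\<in>R. N t x" by blast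
  qed
  then obtain h where h: "h \<in> Pi\<^sub>E I A" "\<forall>t\<in>Q. N t h" by blast
  have "inj_on h I"
    using h(2) by (auto simp: inj_on_def N_def Q_def)
  then show ?thesis using that h(1) by (auto simp: PiE_iff)
qed

section \<open>Folner sets\<close>

lemma finitely_additive_UN:
  fixes \<nu> :: "'m set \<Rightarrow> real"
  assumes add: "\<And>S T. S \<subseteq> X \<Longrightarrow> T \<subseteq> X \<Longrightarrow> S \<inter> T = {} \<Longrightarrow> \<nu> (S \<union> T) = \<nu> S + \<nu> T"
    and "finite I" "disjoint_family_on S I" "\<And>i. i \<in> I \<Longrightarrow> S i \<subseteq> X"
  shows "\<nu> (\<Union>i\<in>I. S i) = (\<Sum>i\<in>I. \<nu> (S i))"
  using assms(2-)
proof (induction I rule: finite_induct)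
  case empty
  show ?case using add[of "{}" "{}"] by simp
next
  case (insert i I)
  have dj: "S i \<inter> S j = {}" if "j \<in> I" for j
    using disjoint_family_onD[OF insert.prems(1), of i j] insert.hyps that by auto
  have "\<nu> (S i \<union> (\<Union>j\<in>I. S j)) = \<nu> (S i) + \<nu> (\<Union>j\<in>I. S j)"
    using dj insert.prems by (intro add) auto
  moreover have "disjoint_family_on S I"
    using insert.prems by (auto simp: disjoint_family_on_def)
  ultimately show ?case using insert by simp
qed

text \<open>If every finite set expanded by the factor \<open>(q + 1) / q\<close>, Hall's theorem would give an
  injection from \<open>q + 1\<close> copies of \<open>X\<close> to \<open>q\<close> copies of \<open>X\<close> that is piecewise one of the maps
  \<open>g k\<close>, so that an invariant measure would satisfy \<open>q + 1 \<le> q\<close>.\<close>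

lemma folner_set:
  fixes g :: "'k \<Rightarrow> 'm \<Rightarrow> 'm" and \<nu> :: "'m set \<Rightarrow> real"
  assumes fin: "finite K"
    and maps: "\<And>k m. k \<in> K \<Longrightarrow> m \<in> X \<Longrightarrow> g k m \<in> X"
    and inj: "\<And>k. k \<in> K \<Longrightarrow> inj_on (g k) X"
    and add: "\<And>S T. S \<subseteq> X \<Longrightarrow> T \<subseteq> X \<Longrightarrow> S \<inter> T = {} \<Longrightarrow> \<nu> (S \<union> T) = \<nu> S + \<nu> T"
    and nonneg: "\<And>S. S \<subseteq> X \<Longrightarrow> 0 \<le> \<nu> S"
    and total: "\<nu> X = 1"
    and inv: "\<And>k S. k \<in> K \<Longrightarrow> S \<subseteq> X \<Longrightarrow> \<nu> (g k ` S) = \<nu> S"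
  obtains (found) F where "finite F" "F \<subseteq> X" "q * card (\<Union>k\<in>K. g k ` F) < Suc q * card F"
proof (rule ccontr)
  assume "\<not> thesis"
  then have expand: "Suc q * card F \<le> q * card (\<Union>k\<in>K. g k ` F)" if F: "finite F" "F \<subseteq> X" for F
    using found[OF F] by (meson not_less)
  \<comment> \<open>Off by one on purpose: \<open>{..q}\<close> indexes \<open>q + 1\<close> source
    copies, \<open>{..<q}\<close> only \<open>q\<close> target copies.\<close>
  define N where "N = (\<lambda>p :: 'm \<times> nat. ((\<lambda>k. g k (fst p)) ` K) \<times> {..<q})"
  obtain h where h: "inj_on h (X \<times> {..q})" "\<And>p. p \<in> X \<times> {..q} \<Longrightarrow> h p \<in> N p"
  proof (rule hall_locally_finite[of "X \<times> {..q}" N])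
    show "finite (N p)" for p using fin by (simp add: N_def)
    show "card J \<le> card (\<Union> (N ` J))" if J: "finite J" "J \<subseteq> X \<times> {..q}" for J
    proof -
      have "card J \<le> card (fst ` J \<times> {..q})"
        using J by (intro card_mono) force+
      also have "\<dots> = Suc q * card (fst ` J)" by (simp add: card_cartesian_product)
      also have "\<dots> \<le> q * card (\<Union>k\<in>K. g k ` fst ` J)"
        using J by (intro expand) auto
      also have "\<dots> = card ((\<Union>k\<in>K. g k ` fst ` J) \<times> {..<q})"
        by (simp add: card_cartesian_product)
      also have "(\<Union>k\<in>K. g k ` fst ` J) \<times> {..<q} = \<Union> (N ` J)"
        unfolding N_def by blast
      finally show ?thesis .
    qed
  qed blast
  have "\<forall>p\<in>X \<times> {..q}. \<exists>k\<in>K. fst (h p) = g k (fst p)"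
  proof
    fix p assume "p \<in> X \<times> {..q}"
    from h(2)[OF this] show "\<exists>k\<in>K. fst (h p) = g k (fst p)" by (auto simp: N_def)
  qed
  then obtain \<kappa> where \<kappa>: "\<And>p. p \<in> X \<times> {..q} \<Longrightarrow> \<kappa> p \<in> K \<and> fst (h p) = g (\<kappa> p) (fst p)"
    by metis
  have snd_h: "snd (h p) < q" if "p \<in> X \<times> {..q}" for p
    using h(2)[OF that] by (auto simp: N_def)
  \<comment> \<open>The part of source copy \<open>i\<close> that \<open>h\<close> moves by
    \<open>g k\<close> into target copy \<open>j\<close>. For fixed \<open>i\<close> these parts
    partition \<open>X\<close>; for fixed \<open>j\<close> their images are disjoint because
    \<open>h\<close> is injective. Summing the measures both ways gives
    \<open>q + 1 \<le> q\<close>.\<close>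
  define S where "S i k j = {m \<in> X. \<kappa> (m, i) = k \<and> snd (h (m, i)) = j}" for i k j
  have SX: "S i k j \<subseteq> X" for i k j by (auto simp: S_def)
  have rows: "(\<Sum>(k, j)\<in>K \<times> {..<q}. \<nu> (S i k j)) = 1" if i: "i \<le> q" for i
  proof -
    have "(\<Sum>p\<in>K \<times> {..<q}. \<nu> (case p of (k, j) \<Rightarrow> S i k j))
        = \<nu> (\<Union>p\<in>K \<times> {..<q}. case p of (k, j) \<Rightarrow> S i k j)"
      using fin SX
      by (intro finitely_additive_UN[of X, symmetric] add)
        (auto simp: disjoint_family_on_def S_def)
    also have "(\<Union>p\<in>K \<times> {..<q}. case p of (k, j) \<Rightarrow> S i k j) = X"
      using i \<kappa> snd_h by (auto simp: S_def)
    finally show ?thesis using total by (simp add: case_prod_beta')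
  qed
  have columns: "(\<Sum>(i, k)\<in>{..q} \<times> K. \<nu> (S i k j)) \<le> 1" if j: "j < q" for j
  proof -
    define U where "U = (\<Union>p\<in>{..q} \<times> K. case p of (i, k) \<Rightarrow> g k ` S i k j)"
    have UX: "U \<subseteq> X" using maps by (auto simp: U_def S_def)
    have "(\<Sum>(i, k)\<in>{..q} \<times> K. \<nu> (S i k j)) = (\<Sum>p\<in>{..q} \<times> K. \<nu> (case p of (i, k) \<Rightarrow> g k ` S i k j))"
      using inv SX by (intro sum.cong) auto
    also have "\<dots> = \<nu> U"
      unfolding U_def
    proof (intro finitely_additive_UN[of X, symmetric] add)
      show "disjoint_family_on (\<lambda>p. case p of (i, k) \<Rightarrow> g k ` S i k j) ({..q} \<times> K)"
      proof (unfold disjoint_family_on_def, intro ballI impI)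
        fix p p' assume pp: "p \<in> {..q} \<times> K" "p' \<in> {..q} \<times> K" "p \<noteq> p'"
        obtain i k i' k' where p: "p = (i, k)" "p' = (i', k')" by fastforce
        have False if "x \<in> g k ` S i k j" "x \<in> g k' ` S i' k' j" for x
        proof -
          obtain m m' where m: "m \<in> S i k j" "x = g k m" and m': "m' \<in> S i' k' j" "x = g k' m'"
            using \<open>x \<in> g k ` S i k j\<close> \<open>x \<in> g k' ` S i' k' j\<close> by blast
          have mem: "(m, i) \<in> X \<times> {..q}" "(m', i') \<in> X \<times> {..q}"
            using pp p m m' by (auto simp: S_def)
          have "h (m, i) = h (m', i')"
            using \<kappa>[OF mem(1)] \<kappa>[OF mem(2)] m m' by (intro prod_eqI) (auto simp: S_def)
          then have "(m, i) = (m', i')" using h(1) mem by (auto dest: inj_onD)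
          then have "m = m'" "i = i'" by simp_all
          moreover from this have "k = k'" using m(1) m'(1) by (simp add: S_def)
          ultimately show False using pp(3) p by simp
        qed
        then show "(case p of (i, k) \<Rightarrow> g k ` S i k j) \<inter> (case p' of (i, k) \<Rightarrow> g k ` S i k j) = {}"
          by (auto simp: p)
      qed
    qed (use fin maps in \<open>auto simp: S_def\<close>)
    also have "\<dots> \<le> \<nu> U + \<nu> (X - U)" using nonneg[of "X - U"] by simp
    also have "\<dots> = 1" using add[of U "X - U"] UX total by (simp add: Un_absorb1)
    finally show ?thesis .
  qed
  have "real (Suc q) = (\<Sum>i\<le>q. \<Sum>k\<in>K. \<Sum>j<q. \<nu> (S i k j))"
    using rows by (simp add: sum.cartesian_product)
  also have "\<dots> = (\<Sum>i\<le>q. \<Sum>j<q. \<Sum>k\<in>K. \<nu> (S i k j))"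
    by (intro sum.cong refl sum.swap)
  also have "\<dots> = (\<Sum>j<q. \<Sum>i\<le>q. \<Sum>k\<in>K. \<nu> (S i k j))"
    by (rule sum.swap)
  also have "\<dots> \<le> (\<Sum>j<q. 1)"
    using columns by (intro sum_mono) (simp add: sum.cartesian_product)
  finally show False by simp
qed

text \<open>The passage from means to finitely additive probability measures, the form in which the
  Folner argument uses amenability.\<close>

lemma mean_of_indicators:
  fixes \<mu> :: "('m \<Rightarrow> real) \<Rightarrow> real"
  assumes "is_mean M \<mu>" "carrier M \<noteq> {}"
  defines "\<nu> \<equiv> \<lambda>S. \<mu> (\<lambda>m\<in>carrier M. indicator S m)"
  shows "S \<inter> T = {} \<Longrightarrow> \<nu> (S \<union> T) = \<nu> S + \<nu> T"
    and "0 \<le> \<nu> S"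
    and "\<nu> (carrier M) = 1"
    and "(\<lambda>m\<in>carrier M. indicator S m) \<in> ell_infinity M"
proof -
  have ind: "(\<lambda>m\<in>carrier M. indicator S m) \<in> ell_infinity M" for S :: "'m set"
    by (auto simp: ell_infinity_def indicator_def intro!: boundedI[of _ 1])
  then show "(\<lambda>m\<in>carrier M. indicator S m) \<in> ell_infinity M" .
  show "\<nu> (S \<union> T) = \<nu> S + \<nu> T" if "S \<inter> T = {}"
  proof -
    have "(\<lambda>m\<in>carrier M. indicator (S \<union> T) m :: real) = (\<lambda>m\<in>carrier M.
        (\<lambda>m\<in>carrier M. indicator S m) m + (\<lambda>m\<in>carrier M. indicator T m) m)"
      using that by (auto simp: indicator_def fun_eq_iff restrict_def)
    moreover have "\<mu> (\<lambda>m\<in>carrier M. f m + g m) = \<mu> f + \<mu> g"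
      if "f \<in> ell_infinity M" "g \<in> ell_infinity M" for f g
      using assms(1) that unfolding is_mean_def by blast
    ultimately show ?thesis
      using ind unfolding \<nu>_def by presburger
  qed
  have bnd: "(INF m\<in>carrier M. (\<lambda>m\<in>carrier M. indicator S m :: real) m) \<le> \<nu> S"
    "\<nu> S \<le> (SUP m\<in>carrier M. (\<lambda>m\<in>carrier M. indicator S m :: real) m)" for S
    using assms(1) ind[of S] unfolding is_mean_def \<nu>_def by blast+
  have "0 \<le> (INF m\<in>carrier M. (\<lambda>m\<in>carrier M. indicator S m :: real) m)"
    using assms(2) by (intro cINF_greatest) auto
  then show "0 \<le> \<nu> S" using bnd(1)[of S] by linarith
  show "\<nu> (carrier M) = 1"
    using bnd[of "carrier M"] assms(2) by simp
qed

section \<open>Counting patterns\<close>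

text \<open>Disjoint places are independent and each excludes one of \<open>card A ^ n\<close>
  patterns. For nonempty \<open>A\<close> the bound on the proportion of remaining configurations is
  \<open>(1 - 1 / card A ^ n) ^ card D\<close>, here multiplied out to stay in the natural
  numbers.\<close>

lemma card_avoiding_patterns:
  fixes A :: "'a set" and \<Omega> :: "'w set" and p :: "'d \<Rightarrow> 'w \<Rightarrow> 'a"
  assumes "finite A" "finite D" "finite \<Omega>"
    and "disjoint_family_on B D"
    and "\<And>d. d \<in> D \<Longrightarrow> B d \<subseteq> \<Omega> \<and> card (B d) = n \<and> p d \<in> B d \<rightarrow>\<^sub>E A"
  shows "card {y \<in> \<Omega> \<rightarrow>\<^sub>E A. \<forall>d\<in>D. restrict y (B d) \<noteq> p d} * (card A ^ n) ^ card D
    \<le> (card A ^ n - 1) ^ card D * card A ^ card \<Omega>"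
  using assms(2-)
proof (induction D arbitrary: \<Omega> rule: finite_induct)
  case empty
  then show ?case using assms(1) by (simp add: card_funcsetE)
next
  case (insert d D)
  let ?c = "card A ^ n"
  let ?G = "\<lambda>\<Omega> D. {y \<in> \<Omega> \<rightarrow>\<^sub>E A. \<forall>d\<in>D. restrict y (B d) \<noteq> p d}"
  let ?\<Omega>' = "\<Omega> - B d"
  have d: "B d \<subseteq> \<Omega>" "card (B d) = n" "p d \<in> B d \<rightarrow>\<^sub>E A"
    using insert.prems(3)[of d] by simp_all
  have finB: "finite (B d)" using d(1) insert.prems(1) by (rule finite_subset)
  have sub: "B e \<subseteq> ?\<Omega>'" if "e \<in> D" for e
    using that insert.prems(3)[of e] insert.hyps(2)
      disjoint_family_onD[OF insert.prems(2), of e d] by auto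
  have IH: "card (?G ?\<Omega>' D) * ?c ^ card D \<le> (?c - 1) ^ card D * card A ^ card ?\<Omega>'"
    using sub insert.prems by (intro insert.IH) (auto simp: disjoint_family_on_def)
  \<comment> \<open>Splits a configuration into its pattern at the place \<open>B d\<close>, with
    one value excluded, and the rest, to which the induction hypothesis applies.\<close>
  define r where "r y = (restrict y (B d), restrict y ?\<Omega>')" for y :: "'w \<Rightarrow> 'a"
  have "inj_on r (?G \<Omega> (insert d D))"
  proof (rule inj_onI)
    fix y z assume y: "y \<in> ?G \<Omega> (insert d D)" and z: "z \<in> ?G \<Omega> (insert d D)" and "r y = r z"
    then have yz: "restrict y (B d) = restrict z (B d)" "restrict y ?\<Omega>' = restrict z ?\<Omega>'"
      by (auto simp: r_def)
    show "y = z"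
    proof (rule PiE_ext[of y \<Omega> "\<lambda>_. A" z])
      fix v assume "v \<in> \<Omega>"
      then show "y v = z v"
        using fun_cong[OF yz(1), of v] fun_cong[OF yz(2), of v] by (cases "v \<in> B d") auto
    qed (use y z in auto)
  qed
  moreover have "r ` ?G \<Omega> (insert d D) \<subseteq> ((B d \<rightarrow>\<^sub>E A) - {p d}) \<times> ?G ?\<Omega>' D"
  proof
    fix t assume "t \<in> r ` ?G \<Omega> (insert d D)"
    then obtain y where y: "y \<in> \<Omega> \<rightarrow>\<^sub>E A" "\<And>e. e \<in> insert d D \<Longrightarrow> restrict y (B e) \<noteq> p e" "t = r y"
      by auto
    have yA: "y v \<in> A" if "v \<in> \<Omega>" for v using y(1) that by auto
    have "restrict y (B d) \<in> (B d \<rightarrow>\<^sub>E A) - {p d}"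
      using yA d(1) y(2)[of d] by auto
    moreover have "restrict (restrict y ?\<Omega>') (B e) \<noteq> p e" if "e \<in> D" for e
      using y(2)[of e] sub[OF that] that by (simp add: restrict_restrict Int_absorb1)
    ultimately show "t \<in> ((B d \<rightarrow>\<^sub>E A) - {p d}) \<times> ?G ?\<Omega>' D"
      using yA y(3) by (auto simp: r_def)
  qed
  moreover have "finite (((B d \<rightarrow>\<^sub>E A) - {p d}) \<times> ?G ?\<Omega>' D)"
  proof (intro finite_cartesian_product finite_Diff)
    show "finite (B d \<rightarrow>\<^sub>E A)" using finB assms(1) by (intro finite_PiE)
    have "finite (?\<Omega>' \<rightarrow>\<^sub>E A)" using insert.prems(1) assms(1) by (intro finite_PiE) auto
    then show "finite (?G ?\<Omega>' D)" by (rule rev_finite_subset) blast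
  qed
  ultimately have "card (?G \<Omega> (insert d D)) \<le> card (((B d \<rightarrow>\<^sub>E A) - {p d}) \<times> ?G ?\<Omega>' D)"
    by (rule card_inj_on_le)
  also have "\<dots> = (?c - 1) * card (?G ?\<Omega>' D)"
    using d finB by (simp add: card_cartesian_product card_funcsetE)
  finally have "card (?G \<Omega> (insert d D)) * ?c ^ card (insert d D)
      \<le> (?c - 1) * card (?G ?\<Omega>' D) * (?c * ?c ^ card D)"
    using insert.hyps by simp
  also have "\<dots> = (?c - 1) * ?c * (card (?G ?\<Omega>' D) * ?c ^ card D)"
    by (simp add: ac_simps)
  also have "\<dots> \<le> (?c - 1) * ?c * ((?c - 1) ^ card D * card A ^ card ?\<Omega>')"
    using IH by (rule mult_left_mono) simp
  also have "\<dots> = (?c - 1) ^ card (insert d D) * card A ^ (n + card ?\<Omega>')"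
    using insert.hyps by (simp add: power_add ac_simps)
  also have "n + card ?\<Omega>' = card \<Omega>"
    using d finB insert.prems(1) card_mono[OF insert.prems(1) d(1)] by (simp add: card_Diff_subset)
  finally show ?case .
qed

text \<open>By maximality every \<open>B e\<close> meets a member of a maximal disjoint subfamily,
  and each member is met by at most \<open>c\<close> of them.\<close>

lemma maximal_packing:
  assumes "finite E" "\<And>e. e \<in> E \<Longrightarrow> B e \<noteq> {}"
    and "\<And>d. d \<in> E \<Longrightarrow> card {e \<in> E. B e \<inter> B d \<noteq> {}} \<le> c"
  obtains D where "D \<subseteq> E" "disjoint_family_on B D" "card E \<le> c * card D"
proof -
  have "finite {D \<in> Pow E. disjoint_family_on B D}" using assms(1) by simp
  moreover have "{} \<in> {D \<in> Pow E. disjoint_family_on B D}" by (simp add: disjoint_family_on_def)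
  ultimately have "\<exists>D\<in>{D \<in> Pow E. disjoint_family_on B D}.
      \<forall>D'\<in>{D \<in> Pow E. disjoint_family_on B D}. D \<subseteq> D' \<longrightarrow> D = D'"
    by (intro finite_has_maximal) auto
  then obtain D where D: "D \<subseteq> E" "disjoint_family_on B D"
    and max: "\<forall>D'. D' \<subseteq> E \<and> disjoint_family_on B D' \<and> D \<subseteq> D' \<longrightarrow> D = D'"
    by auto
  have "e \<in> (\<Union>d\<in>D. {e \<in> E. B e \<inter> B d \<noteq> {}})" if e: "e \<in> E" for e
  proof (rule ccontr)
    assume "\<not> ?thesis"
    then have dj: "B e \<inter> B d = {}" if "d \<in> D" for d using e that by blast
    then have "disjoint_family_on B (insert e D)"
      using D(2) unfolding disjoint_family_on_def by (metis inf_commute insertE)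
    then have "e \<in> D" using max[rule_format, of "insert e D"] D(1) e by blast
    \<comment> \<open>Here \<open>B e\<close> would be disjoint from itself.\<close>
    then show False using dj[of e] assms(2)[OF e] by simp
  qed
  then have "card E \<le> card (\<Union>d\<in>D. {e \<in> E. B e \<inter> B d \<noteq> {}})"
    using assms(1) D(1) by (intro card_mono) (auto intro: finite_subset)
  also have "\<dots> \<le> (\<Sum>d\<in>D. card {e \<in> E. B e \<inter> B d \<noteq> {}})"
    using assms(1) D(1) by (intro card_UN_le) (rule finite_subset)
  also have "\<dots> \<le> c * card D"
    using sum_bounded_above[of D "\<lambda>d. card {e \<in> E. B e \<inter> B d \<noteq> {}}" c] assms(3) D(1)
    by (auto simp: mult.commute)
  finally show ?thesis using that D by blast
qed

section \<open>Locality of injective cellular automata\<close>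

text \<open>One half of the Curtis-Hedlund theorem: uniform continuity, tested on the entourage of
  pairs that agree at \<open>m\<close>.\<close>

lemma cellular_automaton_local:
  assumes "cellular_automaton M A \<tau>" "m \<in> carrier M"
  obtains F where "finite F" "F \<subseteq> carrier M"
    "\<forall>x\<in>configurations M A. \<forall>y\<in>configurations M A. (\<forall>j\<in>F. x j = y j) \<longrightarrow> \<tau> x m = \<tau> y m"
proof -
  have "u m = v m" if "(u, v) \<in> agree_on M A {m}" for u v
  proof -
    have "restrict u {m} = restrict v {m}" using that unfolding agree_on_def by blast
    from fun_cong[OF this, of m] show ?thesis by simp
  qed
  then have "eventually (\<lambda>(u, v). u m = v m) (prodiscrete_uniformity M A)"
    unfolding eventually_prodiscrete_uniformity using assms(2) by (intro exI[of _ "{m}"]) auto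
  moreover have "filterlim (\<lambda>(x, y). (\<tau> x, \<tau> y)) (prodiscrete_uniformity M A) (prodiscrete_uniformity M A)"
    using assms(1) by (simp add: cellular_automaton_def)
  ultimately have "eventually (\<lambda>(x, y). \<tau> x m = \<tau> y m) (prodiscrete_uniformity M A)"
    by (auto simp: filterlim_iff case_prod_beta')
  then obtain F where F: "finite F" "F \<subseteq> carrier M"
    "\<forall>(x, y)\<in>agree_on M A F. \<tau> x m = \<tau> y m"
    unfolding eventually_prodiscrete_uniformity by blast
  have "\<tau> x m = \<tau> y m"
    if "x \<in> configurations M A" "y \<in> configurations M A" "\<forall>j\<in>F. x j = y j" for x y
  proof -
    have "(x, y) \<in> agree_on M A F"
      using that by (auto simp: agree_on_def intro: restrict_ext)
    then show ?thesis using F(3) by blast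
  qed
  then have "\<forall>x\<in>configurations M A. \<forall>y\<in>configurations M A. (\<forall>j\<in>F. x j = y j) \<longrightarrow> \<tau> x m = \<tau> y m"
    by blast
  with F(1,2) show ?thesis by (rule that)
qed

text \<open>If every finite \<open>F\<close> failed, a limit of the failing pairs would be two
  configurations that differ at \<open>i\<close> and have the same image.\<close>

lemma injective_cellular_automaton_local:
  fixes M :: "('m, 'k) monoid_scheme" and A :: "'a set"
  assumes ca: "cellular_automaton M A \<tau>" and "finite A"
    and inj: "inj_on \<tau> (configurations M A)" and i: "i \<in> carrier M"
  obtains (found) F where "finite F" "F \<subseteq> carrier M"
    "\<forall>x\<in>configurations M A. \<forall>y\<in>configurations M A. (\<forall>m\<in>F. \<tau> x m = \<tau> y m) \<longrightarrow> x i = y i"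
proof (rule ccontr)
  assume "\<not> thesis"
  then have neg: "\<exists>x\<in>configurations M A. \<exists>y\<in>configurations M A. (\<forall>m\<in>F. \<tau> x m = \<tau> y m) \<and> x i \<noteq> y i"
    if F: "finite F" "F \<subseteq> carrier M" for F
    using found[OF F] by blast
  \<comment> \<open>A pair of configurations is coded as one configuration over
    \<open>A \<times> A\<close>, with projections \<open>f\<close> and \<open>g\<close>, to fit the
    compactness lemma.\<close>
  define f where "f z = (\<lambda>j\<in>carrier M. fst (z j))" for z :: "'m \<Rightarrow> 'a \<times> 'a"
  define g where "g z = (\<lambda>j\<in>carrier M. snd (z j))" for z :: "'m \<Rightarrow> 'a \<times> 'a"
  \<comment> \<open>The inequality at \<open>i\<close> is part of every condition, so that it
    survives in the limit; this is why \<open>i\<close> joins the coordinates read by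
    \<open>Q m\<close>.\<close>
  define Q where "Q m z \<longleftrightarrow> \<tau> (f z) m = \<tau> (g z) m \<and> f z i \<noteq> g z i" for m z
  let ?Z = "carrier M \<rightarrow>\<^sub>E A \<times> A"
  have fg: "f z \<in> configurations M A" "g z \<in> configurations M A" if "z \<in> ?Z" for z
    using that by (auto simp: f_def g_def configurations_def PiE_iff mem_Times_iff)
  have "\<exists>z\<in>?Z. \<forall>m\<in>carrier M. Q m z"
  proof (rule local_predicates_compact)
    show "finite (A \<times> A)" using assms(2) by simp
  next
    fix m assume m: "m \<in> carrier M"
    obtain F where F: "finite F" "F \<subseteq> carrier M"
      "\<forall>x\<in>configurations M A. \<forall>y\<in>configurations M A. (\<forall>j\<in>F. x j = y j) \<longrightarrow> \<tau> x m = \<tau> y m"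
      using cellular_automaton_local[OF ca m] by blast
    have "Q m y" if "x \<in> ?Z" "y \<in> ?Z" "\<forall>j\<in>insert i F. x j = y j" "Q m x" for x y
    proof -
      have "\<tau> (f x) m = \<tau> (f y) m"
        using that fg F(2) by (intro F(3)[rule_format]) (auto simp: f_def)
      moreover have "\<tau> (g x) m = \<tau> (g y) m"
        using that fg F(2) by (intro F(3)[rule_format]) (auto simp: g_def)
      moreover have "f x i = f y i" "g x i = g y i"
        using that(3) by (simp_all add: f_def g_def)
      ultimately show ?thesis using that(4) by (simp add: Q_def)
    qed
    then have "\<forall>x\<in>?Z. \<forall>y\<in>?Z. (\<forall>j\<in>insert i F. x j = y j) \<longrightarrow> Q m x \<longrightarrow> Q m y"
      by blast
    moreover have "finite (insert i F)" "insert i F \<subseteq> carrier M" using F(1,2) i by auto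
    ultimately show "\<exists>J. finite J \<and> J \<subseteq> carrier M \<and>
      (\<forall>x\<in>?Z. \<forall>y\<in>?Z. (\<forall>j\<in>J. x j = y j) \<longrightarrow> Q m x \<longrightarrow> Q m y)"
      by blast
  next
    fix F assume F: "finite F" "F \<subseteq> carrier M"
    obtain x y where xy: "x \<in> configurations M A" "y \<in> configurations M A"
      "\<forall>m\<in>F. \<tau> x m = \<tau> y m" "x i \<noteq> y i"
      using neg[OF F] by blast
    define z where "z = (\<lambda>j\<in>carrier M. (x j, y j))"
    have "z \<in> ?Z" using xy by (auto simp: z_def configurations_def)
    moreover have "f z = x" "g z = y"
      using xy
      by (auto simp: f_def g_def z_def configurations_def PiE_def
          intro!: extensionalityI[of _ "carrier M"])
    ultimately show "\<exists>z\<in>?Z. \<forall>m\<in>F. Q m z"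
      using xy(3,4) by (intro bexI[of _ z]) (simp_all add: Q_def)
  qed
  then obtain z where z: "z \<in> ?Z" "\<forall>m\<in>carrier M. Q m z" by blast
  have "\<tau> (f z) \<in> carrier M \<rightarrow>\<^sub>E A" "\<tau> (g z) \<in> carrier M \<rightarrow>\<^sub>E A"
    using ca fg[OF z(1)] by (auto simp: cellular_automaton_def configurations_def)
  then have "\<tau> (f z) = \<tau> (g z)"
    using z(2) by (intro PiE_ext) (auto simp: Q_def)
  then have "f z = g z" using inj fg[OF z(1)] by (auto dest: inj_onD)
  then show False using z(2) i by (simp add: Q_def)
qed

text \<open>The image of \<open>\<tau>\<close> is closed by compactness, so a missed configuration
  is already missed on a finite window.\<close>

lemma cellular_automaton_forbidden_pattern:
  fixes M :: "('m, 'k) monoid_scheme" and A :: "'a set"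
  assumes ca: "cellular_automaton M A \<tau>" and "finite A"
    and y: "y \<in> configurations M A" "y \<notin> \<tau> ` configurations M A"
  obtains (found) P where "finite P" "P \<subseteq> carrier M"
    "\<forall>x\<in>configurations M A. \<exists>m\<in>P. \<tau> x m \<noteq> y m"
proof (rule ccontr)
  assume "\<not> thesis"
  then have neg: "\<exists>x\<in>configurations M A. \<forall>m\<in>F. \<tau> x m = y m"
    if F: "finite F" "F \<subseteq> carrier M" for F
    using found[OF F] by blast
  define Q where "Q m x \<longleftrightarrow> \<tau> x m = y m" for m x
  have "\<exists>x\<in>carrier M \<rightarrow>\<^sub>E A. \<forall>m\<in>carrier M. Q m x"
  proof (rule local_predicates_compact)
    show "finite A" using assms(2) .
  next
    fix m assume m: "m \<in> carrier M"
    obtain F where "finite F" "F \<subseteq> carrier M"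
      "\<forall>x\<in>configurations M A. \<forall>y\<in>configurations M A. (\<forall>j\<in>F. x j = y j) \<longrightarrow> \<tau> x m = \<tau> y m"
      using cellular_automaton_local[OF ca m] by blast
    then show "\<exists>J. finite J \<and> J \<subseteq> carrier M \<and> (\<forall>x\<in>carrier M \<rightarrow>\<^sub>E A. \<forall>y\<in>carrier M \<rightarrow>\<^sub>E A.
        (\<forall>j\<in>J. x j = y j) \<longrightarrow> Q m x \<longrightarrow> Q m y)"
      unfolding Q_def configurations_def by metis
  next
    fix F assume "finite F" "F \<subseteq> carrier M"
    then show "\<exists>x\<in>carrier M \<rightarrow>\<^sub>E A. \<forall>m\<in>F. Q m x"
      using neg by (simp add: Q_def configurations_def)
  qed
  then obtain x where x: "x \<in> carrier M \<rightarrow>\<^sub>E A" "\<And>m. m \<in> carrier M \<Longrightarrow> \<tau> x m = y m"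
    unfolding Q_def by blast
  have "\<tau> x \<in> carrier M \<rightarrow>\<^sub>E A" "y \<in> carrier M \<rightarrow>\<^sub>E A"
    using ca x(1) y(1) by (auto simp: cellular_automaton_def configurations_def)
  then have "\<tau> x = y" using x(2) by (intro PiE_ext)
  then show False using x(1) y(2) by (auto simp: configurations_def)
qed

section \<open>Finite models of a monoid\<close>

text \<open>Far from the boundary \<open>\<Omega> - E\<close>, the maps \<open>\<phi> k\<close> with \<open>k \<in> K\<close> behave like a free left
  action of \<open>M\<close> by injective maps.\<close>

definition translation_model ::
    "('m, 'k) monoid_scheme \<Rightarrow> 'm set \<Rightarrow> 'w set \<Rightarrow> 'w set \<Rightarrow> ('m \<Rightarrow> 'w \<Rightarrow> 'w) \<Rightarrow> bool" where
  "translation_model M K \<Omega> E \<phi> \<longleftrightarrow>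
    finite \<Omega> \<and> E \<subseteq> \<Omega> \<and>
    (\<forall>w\<in>E. \<phi> \<one>\<^bsub>M\<^esub> w = w) \<and>
    (\<forall>k\<in>K. \<forall>w\<in>E. \<phi> k w \<in> \<Omega>) \<and>
    (\<forall>j\<in>K. \<forall>k\<in>K. \<forall>w\<in>E. \<phi> j (\<phi> k w) = \<phi> (j \<otimes>\<^bsub>M\<^esub> k) w) \<and>
    (\<forall>w\<in>E. inj_on (\<lambda>k. \<phi> k w) K) \<and>
    (\<forall>k\<in>K. inj_on (\<phi> k) E)"

text \<open>The view from \<open>w\<close> along its orbit. The default \<open>a\<close> makes it a
  full configuration although \<open>\<phi> m w\<close> is controlled only for \<open>w\<close> in
  \<open>E\<close> and \<open>m\<close> in \<open>K\<close>.\<close>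

definition pullback ::
    "('m, 'k) monoid_scheme \<Rightarrow> 'w set \<Rightarrow> ('m \<Rightarrow> 'w \<Rightarrow> 'w) \<Rightarrow> 'a \<Rightarrow> ('w \<Rightarrow> 'a) \<Rightarrow> 'w \<Rightarrow> 'm \<Rightarrow> 'a" where
  "pullback M \<Omega> \<phi> a x w = (\<lambda>m\<in>carrier M. if \<phi> m w \<in> \<Omega> then x (\<phi> m w) else a)"

lemma pullback_in_configurations:
  assumes "a \<in> A" "x \<in> \<Omega> \<rightarrow>\<^sub>E A"
  shows "pullback M \<Omega> \<phi> a x w \<in> configurations M A"
  using assms by (auto simp: pullback_def configurations_def)

definition model_automaton ::
    "('m, 'k) monoid_scheme \<Rightarrow> 'w set \<Rightarrow> ('m \<Rightarrow> 'w \<Rightarrow> 'w) \<Rightarrow> 'a \<Rightarrow> (('m \<Rightarrow> 'a) \<Rightarrow> 'm \<Rightarrow> 'a) \<Rightarrow>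
      ('w \<Rightarrow> 'a) \<Rightarrow> 'w \<Rightarrow> 'a" where
  "model_automaton M \<Omega> \<phi> a \<tau> x = (\<lambda>w\<in>\<Omega>. \<tau> (pullback M \<Omega> \<phi> a x w) \<one>\<^bsub>M\<^esub>)"

text \<open>On the memory set, the view from \<open>\<phi> k w\<close> is the \<open>k\<close>-shift
  of the view from \<open>w\<close>. Thus a single genuine configuration of \<open>M\<close>
  accounts for the model's values at all \<open>\<phi> k w\<close>; decoding and pattern avoidance
  both rest on this.\<close>

lemma model_automaton_eq:
  assumes "monoid M" and ca: "cellular_automaton M A \<tau>"
    and K: "K \<subseteq> carrier M"
    and memory: "\<forall>x\<in>configurations M A. \<forall>y\<in>configurations M A.
      (\<forall>j\<in>K. x j = y j) \<longrightarrow> \<tau> x \<one>\<^bsub>M\<^esub> = \<tau> y \<one>\<^bsub>M\<^esub>"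
    and model: "translation_model M K \<Omega> E \<phi>"
    and "a \<in> A" "x \<in> \<Omega> \<rightarrow>\<^sub>E A" "w \<in> E" "k \<in> K"
  shows "model_automaton M \<Omega> \<phi> a \<tau> x (\<phi> k w) = \<tau> (pullback M \<Omega> \<phi> a x w) k"
proof -
  interpret monoid M by fact
  let ?p = "pullback M \<Omega> \<phi> a x"
  have k: "k \<in> carrier M" using K \<open>k \<in> K\<close> by blast
  have conf: "?p v \<in> configurations M A" for v
    using assms by (intro pullback_in_configurations)
  have sh: "shift M k (?p w) \<in> configurations M A"
    using conf[of w] k by (auto simp: shift_def configurations_def)
  have "\<tau> (?p w) k = shift M k (\<tau> (?p w)) \<one>\<^bsub>M\<^esub>"
    using k by (simp add: shift_def)
  also have "\<dots> = \<tau> (shift M k (?p w)) \<one>\<^bsub>M\<^esub>"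
    using ca k conf by (simp add: cellular_automaton_def)
  also have "\<dots> = \<tau> (?p (\<phi> k w)) \<one>\<^bsub>M\<^esub>"
  proof (rule memory[rule_format, OF sh conf])
    fix j assume j: "j \<in> K"
    then have "\<phi> j (\<phi> k w) = \<phi> (j \<otimes>\<^bsub>M\<^esub> k) w"
      using model assms(8,9) by (simp add: translation_model_def)
    \<comment> \<open>Both sides look up the same point, so they agree even if it lies outside
      \<open>\<Omega>\<close>, where both give \<open>a\<close>.\<close>
    then show "shift M k (?p w) j = ?p (\<phi> k w) j"
      using j k K by (auto simp: shift_def pullback_def)
  qed
  also have "\<dots> = model_automaton M \<Omega> \<phi> a \<tau> x (\<phi> k w)"
    using model assms(8,9) by (simp add: model_automaton_def translation_model_def)
  finally show ?thesis by simp
qed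

text \<open>Configurations that equal \<open>a\<close> off \<open>E\<close> can be decoded: the
  letter at \<open>w\<close> in \<open>E\<close> is determined by the image at the points
  \<open>\<phi> j w\<close> with \<open>j\<close> in \<open>K\<close>, all of which lie in
  \<open>\<Omega>\<close>.\<close>

lemma model_automaton_card_image:
  fixes \<Omega> :: "'w set" and A :: "'a set"
  assumes "monoid M" and ca: "cellular_automaton M A \<tau>" and "finite A"
    and K: "K \<subseteq> carrier M"
    and memory: "\<forall>x\<in>configurations M A. \<forall>y\<in>configurations M A.
      (\<forall>j\<in>K. x j = y j) \<longrightarrow> \<tau> x \<one>\<^bsub>M\<^esub> = \<tau> y \<one>\<^bsub>M\<^esub>"
    and inverse: "\<forall>x\<in>configurations M A. \<forall>y\<in>configurations M A.
      (\<forall>j\<in>K. \<tau> x j = \<tau> y j) \<longrightarrow> x \<one>\<^bsub>M\<^esub> = y \<one>\<^bsub>M\<^esub>"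
    and model: "translation_model M K \<Omega> E \<phi>"
    and a: "a \<in> A"
  shows "card A ^ card E \<le> card (model_automaton M \<Omega> \<phi> a \<tau> ` (\<Omega> \<rightarrow>\<^sub>E A))"
proof -
  interpret monoid M by fact
  have fin: "finite \<Omega>" and E: "E \<subseteq> \<Omega>" using model by (simp_all add: translation_model_def)
  let ?T = "model_automaton M \<Omega> \<phi> a \<tau>" and ?p = "pullback M \<Omega> \<phi> a"
  define e where "e u = (\<lambda>w\<in>\<Omega>. if w \<in> E then u w else a)" for u :: "'w \<Rightarrow> 'a"
  have e: "e u \<in> \<Omega> \<rightarrow>\<^sub>E A" if "u \<in> E \<rightarrow>\<^sub>E A" for u
    using that a by (auto simp: e_def)
  have "inj_on (?T \<circ> e) (E \<rightarrow>\<^sub>E A)"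
  proof (rule inj_onI)
    fix u v assume u: "u \<in> E \<rightarrow>\<^sub>E A" and v: "v \<in> E \<rightarrow>\<^sub>E A" and "(?T \<circ> e) u = (?T \<circ> e) v"
    then have T: "?T (e u) = ?T (e v)" by simp
    show "u = v"
    proof (rule PiE_ext[OF u v])
      fix w assume w: "w \<in> E"
      have "\<tau> (?p (e u) w) j = \<tau> (?p (e v) w) j" if "j \<in> K" for j
        using model_automaton_eq[OF assms(1) ca K memory model a e[OF u] w that]
          model_automaton_eq[OF assms(1) ca K memory model a e[OF v] w that] T by simp
      then have "?p (e u) w \<one>\<^bsub>M\<^esub> = ?p (e v) w \<one>\<^bsub>M\<^esub>"
        using inverse[rule_format, OF pullback_in_configurations[OF a e[OF u]]
            pullback_in_configurations[OF a e[OF v]]] by blast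
      then show "u w = v w"
        using model w E by (auto simp: pullback_def translation_model_def e_def)
    qed
  qed
  moreover have "(?T \<circ> e) ` (E \<rightarrow>\<^sub>E A) \<subseteq> ?T ` (\<Omega> \<rightarrow>\<^sub>E A)" using e by auto
  moreover have "finite (?T ` (\<Omega> \<rightarrow>\<^sub>E A))" using fin assms(3) by (intro finite_imageI finite_PiE)
  ultimately have "card (E \<rightarrow>\<^sub>E A) \<le> card (?T ` (\<Omega> \<rightarrow>\<^sub>E A))" by (rule card_inj_on_le)
  moreover have "finite E" using E fin by (rule finite_subset)
  ultimately show ?thesis by (simp add: card_funcsetE)
qed

text \<open>If the places of \<open>e\<close> and \<open>d\<close> meet, then
  \<open>\<phi> p e = \<phi> q d\<close> for some \<open>p\<close> and \<open>q\<close> in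
  \<open>P\<close>. Each pair \<open>(p, q)\<close> allows at most one \<open>e\<close> by
  injectivity of \<open>\<phi> p\<close>, which gives the factor \<open>card P ^ 2\<close>.\<close>

lemma translation_model_packing:
  assumes model: "translation_model M K \<Omega> E \<phi>"
    and "P \<subseteq> K" "finite P" "P \<noteq> {}"
  obtains D where "D \<subseteq> E" "disjoint_family_on (\<lambda>w. (\<lambda>m. \<phi> m w) ` P) D"
    "card E \<le> card P ^ 2 * card D"
proof (rule maximal_packing)
  show finE: "finite E" using model by (auto simp: translation_model_def intro: finite_subset)
  show "(\<lambda>m. \<phi> m w) ` P \<noteq> {}" for w using assms(4) by blast
  show "card {e \<in> E. (\<lambda>m. \<phi> m e) ` P \<inter> (\<lambda>m. \<phi> m d) ` P \<noteq> {}} \<le> card P ^ 2" if d: "d \<in> E" for d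
  proof -
    let ?S = "\<lambda>q. {e \<in> E. \<phi> (fst q) e = \<phi> (snd q) d}"
    have "card (?S q) \<le> 1" if "q \<in> P \<times> P" for q
    proof -
      have "inj_on (\<phi> (fst q)) E"
        using model assms(2) that by (auto simp: translation_model_def)
      then have "\<forall>e\<in>?S q. \<forall>e'\<in>?S q. e = e'" by (auto simp: inj_on_def)
      then show ?thesis using finE by (simp add: card_le_Suc0_iff_eq)
    qed
    then have "(\<Sum>q\<in>P \<times> P. card (?S q)) \<le> card (P \<times> P) * 1"
      using sum_bounded_above[of "P \<times> P" "\<lambda>q. card (?S q)" 1] by simp
    moreover have "card (\<Union>q\<in>P \<times> P. ?S q) \<le> (\<Sum>q\<in>P \<times> P. card (?S q))"
      using assms(3) by (intro card_UN_le) simp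
    moreover have "card {e \<in> E. (\<lambda>m. \<phi> m e) ` P \<inter> (\<lambda>m. \<phi> m d) ` P \<noteq> {}} \<le> card (\<Union>q\<in>P \<times> P. ?S q)"
      using finE assms(3) by (intro card_mono) auto
    ultimately show ?thesis by (simp add: card_cartesian_product power2_eq_square)
  qed
qed

text \<open>\<open>(1 - 1 / c) ^ s\<close> tends to 0. With \<open>c\<close> the number of patterns
  at a place and \<open>a\<close> the alphabet size, \<open>s\<close> avoided patterns outweigh one
  free cell.\<close>

lemma power_gap:
  fixes a c :: nat
  assumes "0 < c"
  obtains s where "(c - 1) ^ s * a < c ^ s"
proof -
  have "(\<lambda>s. (real (c - 1) / real c) ^ s) \<longlonglongrightarrow> 0"
    using assms by (intro LIMSEQ_power_zero) (simp add: of_nat_diff field_simps)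
  then have "eventually (\<lambda>s. (real (c - 1) / real c) ^ s < 1 / (real a + 1)) sequentially"
    by (rule order_tendstoD(2)) simp
  then obtain s where "(real (c - 1) / real c) ^ s < 1 / (real a + 1)"
    by (auto simp: eventually_sequentially)
  then have "real (c - 1) ^ s * (real a + 1) < real c ^ s"
    using assms by (simp add: field_simps power_divide)
  moreover have "real (c - 1) ^ s * real a \<le> real (c - 1) ^ s * (real a + 1)"
    by (intro mult_left_mono) auto
  ultimately have "real ((c - 1) ^ s * a) < real (c ^ s)" by simp
  then show ?thesis using that of_nat_less_iff by blast
qed

lemma power_gap_iterate:
  fixes a c :: nat
  assumes "0 < c" "(c - 1) ^ s * a < c ^ s" "s * r < d"
  shows "(c - 1) ^ d * a ^ r < c ^ d"
proof -
  have d: "d = s * r + (d - s * r)" using assms(3) by simp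
  have "(c - 1) ^ d * a ^ r = ((c - 1) ^ s * a) ^ r * (c - 1) ^ (d - s * r)"
    by (subst d) (simp add: power_add power_mult power_mult_distrib)
  also have "\<dots> \<le> (c ^ s) ^ r * (c - 1) ^ (d - s * r)"
    using assms(2) by (intro mult_right_mono power_mono) auto
  \<comment> \<open>For \<open>r = 0\<close> the blocks give no strict gain; strictness comes from
    the surplus exponent \<open>d - s * r\<close>, which is positive.\<close>
  also have "\<dots> < (c ^ s) ^ r * c ^ (d - s * r)"
    using assms by (intro mult_strict_left_mono power_strict_mono) auto
  also have "\<dots> = c ^ d"
    by (subst (2) d) (simp add: power_add power_mult)
  finally show ?thesis .
qed

text \<open>If \<open>\<tau>\<close> is injective but misses a pattern, the automaton that it induces on a model has at
  least \<open>card A ^ card E\<close> images, none of which shows the missing pattern at any of the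
  \<open>card D\<close> disjoint places of a packing; for a small boundary this is too many.\<close>

lemma surjunctive_if_models:
  fixes M :: "('m, 'k) monoid_scheme"
  assumes "monoid M"
    and models: "\<And>K q. finite K \<Longrightarrow> K \<subseteq> carrier M \<Longrightarrow>
      \<exists>(\<Omega> :: 'w set) E \<phi>. translation_model M K \<Omega> E \<phi> \<and> q * card (\<Omega> - E) < card E"
  shows "surjunctive TYPE('a) M"
  unfolding surjunctive_def
proof (intro allI impI, rule ccontr)
  fix A :: "'a set" and \<tau>
  assume finA: "finite A" and ca: "cellular_automaton M A \<tau>"
    and inj: "inj_on \<tau> (configurations M A)"
    and "\<tau> ` configurations M A \<noteq> configurations M A"
  moreover have "\<tau> ` configurations M A \<subseteq> configurations M A"
    using ca by (auto simp: cellular_automaton_def)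
  ultimately obtain y where y: "y \<in> configurations M A" "y \<notin> \<tau> ` configurations M A" by blast
  interpret monoid M by fact
  obtain K1 where K1: "finite K1" "K1 \<subseteq> carrier M" "\<forall>x\<in>configurations M A. \<forall>y\<in>configurations M A.
      (\<forall>j\<in>K1. x j = y j) \<longrightarrow> \<tau> x \<one>\<^bsub>M\<^esub> = \<tau> y \<one>\<^bsub>M\<^esub>"
    using cellular_automaton_local[OF ca one_closed] by blast
  obtain K2 where K2: "finite K2" "K2 \<subseteq> carrier M" "\<forall>x\<in>configurations M A. \<forall>y\<in>configurations M A.
      (\<forall>j\<in>K2. \<tau> x j = \<tau> y j) \<longrightarrow> x \<one>\<^bsub>M\<^esub> = y \<one>\<^bsub>M\<^esub>"
    using injective_cellular_automaton_local[OF ca finA inj one_closed] by blast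
  obtain P where P: "finite P" "P \<subseteq> carrier M"
    "\<forall>x\<in>configurations M A. \<exists>m\<in>P. \<tau> x m \<noteq> y m"
    using cellular_automaton_forbidden_pattern[OF ca finA y] by blast
  \<comment> \<open>One finite set serves as memory of \<open>\<tau>\<close>, as memory of its
    inverse and as window of the missed pattern.\<close>
  define K where "K = K1 \<union> K2 \<union> P"
  have K: "finite K" "K \<subseteq> carrier M" "P \<subseteq> K" using K1 K2 P by (auto simp: K_def)
  have memory: "\<forall>x\<in>configurations M A. \<forall>y\<in>configurations M A.
      (\<forall>j\<in>K. x j = y j) \<longrightarrow> \<tau> x \<one>\<^bsub>M\<^esub> = \<tau> y \<one>\<^bsub>M\<^esub>"
    using K1(3) unfolding K_def by blast
  have inverse: "\<forall>x\<in>configurations M A. \<forall>y\<in>configurations M A.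
      (\<forall>j\<in>K. \<tau> x j = \<tau> y j) \<longrightarrow> x \<one>\<^bsub>M\<^esub> = y \<one>\<^bsub>M\<^esub>"
    using K2(3) unfolding K_def by blast
  define a where "a = y \<one>\<^bsub>M\<^esub>"
  have a: "a \<in> A" using y(1) by (auto simp: a_def configurations_def)
  have ne: "P \<noteq> {}" using P(3) y(1) by auto
  define n where "n = card P"
  define c where "c = card A ^ n"
  have cA: "0 < card A" using a finA by (auto simp: card_gt_0_iff)
  then have c: "0 < c" by (simp add: c_def)
  obtain s where s: "(c - 1) ^ s * card A < c ^ s" using power_gap[OF c] by blast
  \<comment> \<open>The packing keeps at least one in \<open>n ^ 2\<close> places, and
    \<open>s\<close> avoided places outweigh one boundary cell; hence the factor
    \<open>n ^ 2 * s\<close>.\<close>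
  obtain \<Omega> :: "'w set" and E \<phi> where model: "translation_model M K \<Omega> E \<phi>"
    and small: "(n ^ 2 * s) * card (\<Omega> - E) < card E"
    using models[OF K(1,2)] by blast
  have fin: "finite \<Omega>" and E: "E \<subseteq> \<Omega>" using model by (simp_all add: translation_model_def)
  let ?T = "model_automaton M \<Omega> \<phi> a \<tau>" and ?B = "\<lambda>w. (\<lambda>m. \<phi> m w) ` P"
  obtain D where D: "D \<subseteq> E" "disjoint_family_on ?B D" "card E \<le> n ^ 2 * card D"
    using translation_model_packing[OF model K(3) P(1) ne] unfolding n_def by blast
  \<comment> \<open>The missed pattern, carried to the place of \<open>d\<close> by the orbit map,
    which is injective on \<open>P\<close> because the model is free.\<close>
  define p where "p d = (\<lambda>v\<in>?B d. y (inv_into P (\<lambda>m. \<phi> m d) v))" for d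
  let ?G = "{x \<in> \<Omega> \<rightarrow>\<^sub>E A. \<forall>d\<in>D. restrict x (?B d) \<noteq> p d}"
  have injP: "inj_on (\<lambda>m. \<phi> m d) P" if "d \<in> E" for d
    using model that K(3) by (auto simp: translation_model_def intro: inj_on_subset)
  have avoid: "?T x \<in> ?G" if x: "x \<in> \<Omega> \<rightarrow>\<^sub>E A" for x
  proof -
    have conf: "pullback M \<Omega> \<phi> a x w \<in> configurations M A" for w
      using a x by (rule pullback_in_configurations)
    have "?T x \<in> \<Omega> \<rightarrow>\<^sub>E A"
    proof -
      have "\<tau> (pullback M \<Omega> \<phi> a x w) \<in> configurations M A" for w
        using ca conf by (auto simp: cellular_automaton_def)
      then have "\<tau> (pullback M \<Omega> \<phi> a x w) \<one>\<^bsub>M\<^esub> \<in> A" for w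
        unfolding configurations_def by (rule PiE_mem) simp
      then show ?thesis by (simp add: model_automaton_def)
    qed
    moreover have "restrict (?T x) (?B d) \<noteq> p d" if d: "d \<in> D" for d
    proof
      assume eq: "restrict (?T x) (?B d) = p d"
      have dE: "d \<in> E" using d D(1) by blast
      have "\<tau> (pullback M \<Omega> \<phi> a x d) m = y m" if m: "m \<in> P" for m
      proof -
        have "?T x (\<phi> m d) = y m"
          using fun_cong[OF eq, of "\<phi> m d"] m inv_into_f_f[OF injP[OF dE] m] by (simp add: p_def)
        then show ?thesis
          using model_automaton_eq[OF assms(1) ca K(2) memory model a x dE, of m] m K(3) by auto
      qed
      then show False using P(3) conf by blast
    qed
    ultimately show ?thesis by simp
  qed
  have "card A ^ card E \<le> card (?T ` (\<Omega> \<rightarrow>\<^sub>E A))"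
    using model_automaton_card_image[OF assms(1) ca finA K(2) memory inverse model a] .
  also have "\<dots> \<le> card ?G"
  proof (intro card_mono)
    have "finite (\<Omega> \<rightarrow>\<^sub>E A)" using fin finA by (intro finite_PiE)
    then show "finite ?G" by (rule rev_finite_subset) blast
    show "?T ` (\<Omega> \<rightarrow>\<^sub>E A) \<subseteq> ?G" using avoid by blast
  qed
  finally have "card A ^ card E * c ^ card D \<le> card ?G * c ^ card D" by simp
  also have "\<dots> \<le> (c - 1) ^ card D * card A ^ card \<Omega>"
    unfolding c_def
  proof (rule card_avoiding_patterns)
    show "finite D" using D(1) E fin by (meson finite_subset)
    fix d assume "d \<in> D"
    then have d: "d \<in> E" using D(1) by blast
    have "?B d \<subseteq> \<Omega>" using model d K(3) by (auto simp: translation_model_def)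
    moreover have "card (?B d) = n" using injP[OF d] by (simp add: card_image n_def)
    moreover have "p d \<in> ?B d \<rightarrow>\<^sub>E A"
    proof -
      have "y m \<in> A" if "m \<in> P" for m using y(1) P(2) that by (auto simp: configurations_def)
      then show ?thesis using inv_into_into[of _ "\<lambda>m. \<phi> m d" P] by (simp add: p_def)
    qed
    ultimately show "?B d \<subseteq> \<Omega> \<and> card (?B d) = n \<and> p d \<in> ?B d \<rightarrow>\<^sub>E A" by blast
  qed (use finA fin D(2) in simp_all)
  also have "card \<Omega> = card E + card (\<Omega> - E)"
    using E fin by (metis card_Diff_subset card_mono finite_subset le_add_diff_inverse)
  finally have "card A ^ card E * c ^ card D
      \<le> card A ^ card E * ((c - 1) ^ card D * card A ^ card (\<Omega> - E))"
    by (simp add: power_add ac_simps)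
  \<comment> \<open>With the \<open>E\<close> cells cancelled, only the freedom on the boundary is
    left to make up for the avoided places.\<close>
  then have "c ^ card D \<le> (c - 1) ^ card D * card A ^ card (\<Omega> - E)"
    using cA by simp
  moreover have "s * card (\<Omega> - E) < card D"
  proof -
    have "n ^ 2 * (s * card (\<Omega> - E)) < n ^ 2 * card D"
      using less_le_trans[OF small D(3)] by (simp only: mult.assoc)
    then show ?thesis by simp
  qed
  ultimately show False using power_gap_iterate[OF c s] by (simp add: not_le[symmetric])
qed

section \<open>Models from invariant means\<close>

text \<open>Abstract injections \<open>g k\<close> cover left and right multiplication at
  once.\<close>

lemma invariant_mean_folner:
  assumes "finite K" "is_mean M \<mu>" "carrier M \<noteq> {}"
    and maps: "\<And>k m. k \<in> K \<Longrightarrow> m \<in> carrier M \<Longrightarrow> g k m \<in> carrier M"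
    and inj: "\<And>k. k \<in> K \<Longrightarrow> inj_on (g k) (carrier M)"
    and inv: "\<And>k f. k \<in> K \<Longrightarrow> f \<in> ell_infinity M \<Longrightarrow>
      \<mu> (compose (carrier M) f (\<lambda>m\<in>carrier M. g k m)) = \<mu> f"
  obtains F where "finite F" "F \<subseteq> carrier M" "q * card (\<Union>k\<in>K. g k ` F) < Suc q * card F"
proof (rule folner_set[of K "carrier M" g "\<lambda>S. \<mu> (\<lambda>m\<in>carrier M. indicator S m)" q])
  show "\<mu> (\<lambda>m\<in>carrier M. indicator (g k ` S) m) = \<mu> (\<lambda>m\<in>carrier M. indicator S m)"
    if k: "k \<in> K" and S: "S \<subseteq> carrier M" for k S
  proof -
    \<comment> \<open>An invariant mean controls preimages; injectivity makes \<open>S\<close> the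
      preimage of its image, so images keep their measure.\<close>
    have "g k m \<in> g k ` S \<longleftrightarrow> m \<in> S" if "m \<in> carrier M" for m
      using inj_on_image_mem_iff[OF inj[OF k] that S] .
    then have "compose (carrier M) (\<lambda>m\<in>carrier M. indicator (g k ` S) m :: real)
        (\<lambda>m\<in>carrier M. g k m) = (\<lambda>m\<in>carrier M. indicator S m)"
      using maps[OF k] by (auto simp: compose_def indicator_def fun_eq_iff restrict_def)
    then show ?thesis
      using inv[OF k mean_of_indicators(4)[OF assms(2,3)], of "g k ` S"] by simp
  qed
qed (use assms mean_of_indicators[OF assms(2,3)] in simp_all)

text \<open>The Folner set is the core and its translates fill \<open>\<Omega>\<close>. Left
  cancellation makes the translations injective, right cancellation makes them free.\<close>

lemma left_amenable_model:
  fixes M :: "('m, 'k) monoid_scheme"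
  assumes "monoid_cancel M" "left_amenable M" "finite K" "K \<subseteq> carrier M"
  shows "\<exists>(\<Omega> :: 'm set) E \<phi>. translation_model M K \<Omega> E \<phi> \<and> q * card (\<Omega> - E) < card E"
proof -
  interpret monoid_cancel M by fact
  obtain \<mu> where \<mu>: "left_invariant_mean M \<mu>" using assms(2) by (auto simp: left_amenable_def)
  \<comment> \<open>The identity puts \<open>F\<close> itself inside
    \<open>\<Omega>\<close>.\<close>
  define K' where "K' = insert \<one>\<^bsub>M\<^esub> K"
  have K': "finite K'" "K' \<subseteq> carrier M" using assms(3,4) by (auto simp: K'_def)
  obtain F where F: "finite F" "F \<subseteq> carrier M"
    "q * card (\<Union>k\<in>K'. (\<lambda>m. k \<otimes>\<^bsub>M\<^esub> m) ` F) < Suc q * card F"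
  proof (rule invariant_mean_folner[of K' M \<mu> "\<lambda>k m. k \<otimes>\<^bsub>M\<^esub> m" q])
    show "inj_on (\<lambda>m. k \<otimes>\<^bsub>M\<^esub> m) (carrier M)" if "k \<in> K'" for k
      using that K'(2) l_cancel by (auto simp: inj_on_def)
    show "\<mu> (compose (carrier M) f (\<lambda>m\<in>carrier M. k \<otimes>\<^bsub>M\<^esub> m)) = \<mu> f"
      if "k \<in> K'" "f \<in> ell_infinity M" for k f
      using \<mu> that K'(2) by (auto simp: left_invariant_mean_def left_mult_def)
  qed (use K' \<mu> one_closed in \<open>auto simp: left_invariant_mean_def\<close>)
  define \<Omega> where "\<Omega> = (\<Union>k\<in>K'. (\<lambda>m. k \<otimes>\<^bsub>M\<^esub> m) ` F)"
  have fin: "finite \<Omega>" using K'(1) F(1) by (simp add: \<Omega>_def)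
  have "w \<in> \<Omega>" if "w \<in> F" for w
    unfolding \<Omega>_def using that F(2) by (intro UN_I[of "\<one>\<^bsub>M\<^esub>"] image_eqI[of _ _ w]) (auto simp: K'_def)
  then have FO: "F \<subseteq> \<Omega>" by blast
  have "translation_model M K \<Omega> F (\<lambda>k m. k \<otimes>\<^bsub>M\<^esub> m)"
    unfolding translation_model_def
  proof (intro conjI ballI fin FO)
    fix w assume w: "w \<in> F"
    then have wM: "w \<in> carrier M" using F(2) by blast
    show "\<one>\<^bsub>M\<^esub> \<otimes>\<^bsub>M\<^esub> w = w" using wM by simp
    show "inj_on (\<lambda>k. k \<otimes>\<^bsub>M\<^esub> w) K"
      using wM assms(4) r_cancel by (auto simp: inj_on_def subset_iff)
    show "k \<otimes>\<^bsub>M\<^esub> w \<in> \<Omega>" if "k \<in> K" for k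
      using that w by (auto simp: \<Omega>_def K'_def)
    show "j \<otimes>\<^bsub>M\<^esub> (k \<otimes>\<^bsub>M\<^esub> w) = j \<otimes>\<^bsub>M\<^esub> k \<otimes>\<^bsub>M\<^esub> w" if "j \<in> K" "k \<in> K" for j k
      using that wM assms(4) by (simp add: m_assoc subset_iff)
  next
    show "inj_on (\<lambda>m. k \<otimes>\<^bsub>M\<^esub> m) F" if "k \<in> K" for k
      using that F(2) assms(4) l_cancel by (auto simp: inj_on_def subset_iff)
  qed
  moreover have "card \<Omega> = card F + card (\<Omega> - F)"
    using FO fin F(1) by (simp add: card_Diff_subset card_mono)
  then have "q * card (\<Omega> - F) < card F"
    using F(3) by (simp add: \<Omega>_def[symmetric] algebra_simps)
  ultimately show ?thesis by blast
qed

text \<open>Here \<open>k\<close> acts on the part of a right Folner set where right division by \<open>k\<close> is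
  possible; division by \<open>k\<close> and then by \<open>j\<close> is division by \<open>j k\<close>, so this is a left action.\<close>

lemma right_amenable_model:
  fixes M :: "('m, 'k) monoid_scheme"
  assumes "monoid_cancel M" "right_amenable M" "finite K" "K \<subseteq> carrier M"
  shows "\<exists>(\<Omega> :: 'm set) E \<phi>. translation_model M K \<Omega> E \<phi> \<and> q * card (\<Omega> - E) < card E"
proof -
  interpret monoid_cancel M by fact
  obtain \<mu> where \<mu>: "right_invariant_mean M \<mu>" using assms(2) by (auto simp: right_amenable_def)
  \<comment> \<open>Products are included because the action law needs genuine division by
    \<open>j \<otimes> k\<close>.\<close>
  define K' where "K' = insert \<one>\<^bsub>M\<^esub> (K \<union> (\<lambda>(j, k). j \<otimes>\<^bsub>M\<^esub> k) ` (K \<times> K))"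
  have K': "finite K'" "K' \<subseteq> carrier M" "K \<subseteq> K'" "\<one>\<^bsub>M\<^esub> \<in> K'"
    using assms(3,4) by (auto simp: K'_def)
  have prodK': "j \<otimes>\<^bsub>M\<^esub> k \<in> K'" if "j \<in> K" "k \<in> K" for j k
    using that by (auto simp: K'_def)
  have inj: "inj_on (\<lambda>m. m \<otimes>\<^bsub>M\<^esub> k) (carrier M)" if "k \<in> K'" for k
    using that K'(2) r_cancel by (auto simp: inj_on_def)
  \<comment> \<open>Each of the \<open>card K'\<close> translates of \<open>F\<close> misses
    \<open>card (\<Omega> - F)\<close> points of \<open>\<Omega>\<close>, so their intersection
    \<open>E\<close> misses at most \<open>card K'\<close> times as many. The extra 1 in
    \<open>Suc q\<close> absorbs \<open>card (\<Omega> - E)\<close> when \<open>card F\<close> is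
    bounded by \<open>card \<Omega>\<close>.\<close>
  define r where "r = Suc q * card K'"
  obtain F where F: "finite F" "F \<subseteq> carrier M"
    "r * card (\<Union>k\<in>K'. (\<lambda>m. m \<otimes>\<^bsub>M\<^esub> k) ` F) < Suc r * card F"
  proof (rule invariant_mean_folner[of K' M \<mu> "\<lambda>k m. m \<otimes>\<^bsub>M\<^esub> k" r])
    show "\<mu> (compose (carrier M) f (\<lambda>m\<in>carrier M. m \<otimes>\<^bsub>M\<^esub> k)) = \<mu> f"
      if "k \<in> K'" "f \<in> ell_infinity M" for k f
      using \<mu> that K'(2) by (auto simp: right_invariant_mean_def right_mult_def)
  qed (use K' \<mu> inj one_closed in \<open>auto simp: right_invariant_mean_def\<close>)
  define \<Omega> where "\<Omega> = (\<Union>k\<in>K'. (\<lambda>m. m \<otimes>\<^bsub>M\<^esub> k) ` F)"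
  \<comment> \<open>The points divisible on the right, within \<open>F\<close>, by every element of
    \<open>K'\<close>; there \<open>inv_into\<close> gives true quotients.\<close>
  define E where "E = (\<Inter>k\<in>K'. (\<lambda>m. m \<otimes>\<^bsub>M\<^esub> k) ` F)"
  define \<phi> where "\<phi> k w = inv_into (carrier M) (\<lambda>m. m \<otimes>\<^bsub>M\<^esub> k) w" for k w
  have fin: "finite \<Omega>" using K'(1) F(1) by (simp add: \<Omega>_def)
  have EO: "E \<subseteq> \<Omega>" using K'(4) unfolding E_def \<Omega>_def by blast
  have \<phi>: "\<phi> k (f \<otimes>\<^bsub>M\<^esub> k) = f" if "k \<in> K'" "f \<in> carrier M" for k f
    unfolding \<phi>_def using inv_into_f_f[OF inj[OF that(1)] that(2)] .
  have divide: "\<phi> k w \<in> F \<and> w = \<phi> k w \<otimes>\<^bsub>M\<^esub> k" if k: "k \<in> K'" and w: "w \<in> E" for k w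
  proof -
    obtain f where f: "f \<in> F" "w = f \<otimes>\<^bsub>M\<^esub> k" using k w by (auto simp: E_def)
    then have "\<phi> k w = f" using \<phi>[OF k] F(2) by auto
    then show ?thesis using f by simp
  qed
  have F_eq: "(\<lambda>m. m \<otimes>\<^bsub>M\<^esub> \<one>\<^bsub>M\<^esub>) ` F = F"
    using F(2) by (force simp: image_iff)
  have FO: "F \<subseteq> \<Omega>" using K'(4) F_eq unfolding \<Omega>_def by blast
  have "translation_model M K \<Omega> E \<phi>"
    unfolding translation_model_def
  proof (intro conjI ballI fin EO)
    fix w assume w: "w \<in> E"
    have \<phi>M: "\<phi> k w \<in> carrier M" if "k \<in> K'" for k
      using divide[OF that w] F(2) by blast
    show "\<phi> \<one>\<^bsub>M\<^esub> w = w"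
      using divide[OF K'(4) w] \<phi>M[OF K'(4)] by simp
    show "inj_on (\<lambda>k. \<phi> k w) K"
    proof (rule inj_onI)
      fix j k assume jk: "j \<in> K" "k \<in> K" "\<phi> j w = \<phi> k w"
      then have "\<phi> k w \<otimes>\<^bsub>M\<^esub> j = \<phi> k w \<otimes>\<^bsub>M\<^esub> k"
        using divide[of j w] divide[of k w] K'(3) w by (metis subsetD)
      then show "j = k"
        using \<phi>M[of k] jk K'(3) assms(4) l_cancel by blast
    qed
    show "\<phi> k w \<in> \<Omega>" if "k \<in> K" for k
      using divide[of k w] that K'(3) w FO by blast
    show "\<phi> j (\<phi> k w) = \<phi> (j \<otimes>\<^bsub>M\<^esub> k) w" if jk: "j \<in> K" "k \<in> K" for j k
    proof -
      let ?f = "\<phi> (j \<otimes>\<^bsub>M\<^esub> k) w"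
      have f: "?f \<in> carrier M" using \<phi>M[OF prodK'[OF jk]] .
      have M: "j \<in> carrier M" "k \<in> carrier M" "j \<in> K'" "k \<in> K'" using jk assms(4) K'(3) by auto
      have "w = (?f \<otimes>\<^bsub>M\<^esub> j) \<otimes>\<^bsub>M\<^esub> k"
        using divide[OF prodK'[OF jk] w] f M by (simp add: m_assoc)
      then have "\<phi> k w = ?f \<otimes>\<^bsub>M\<^esub> j"
        using \<phi>[OF M(4), of "?f \<otimes>\<^bsub>M\<^esub> j"] f M(1) by (metis m_closed)
      then show ?thesis using \<phi>[OF M(3) f] by simp
    qed
  next
    show "inj_on (\<phi> k) E" if "k \<in> K" for k
      using divide[of k] that K'(3) by (intro inj_onI) (metis subsetD)
  qed
  moreover have "q * card (\<Omega> - E) < card E"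
  proof -
    have \<Omega>F: "card \<Omega> = card F + card (\<Omega> - F)"
      using FO fin F(1) by (simp add: card_Diff_subset card_mono)
    have part: "card (\<Omega> - (\<lambda>m. m \<otimes>\<^bsub>M\<^esub> k) ` F) = card (\<Omega> - F)" if k: "k \<in> K'" for k
    proof -
      have "card ((\<lambda>m. m \<otimes>\<^bsub>M\<^esub> k) ` F) = card F"
        using inj_on_subset[OF inj[OF k] F(2)] by (rule card_image)
      moreover have "(\<lambda>m. m \<otimes>\<^bsub>M\<^esub> k) ` F \<subseteq> \<Omega>" using k by (auto simp: \<Omega>_def)
      ultimately show ?thesis using F(1) FO by (simp add: card_Diff_subset)
    qed
    have "\<Omega> - E = (\<Union>k\<in>K'. \<Omega> - (\<lambda>m. m \<otimes>\<^bsub>M\<^esub> k) ` F)"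
      by (auto simp: E_def)
    then have "card (\<Omega> - E) \<le> (\<Sum>k\<in>K'. card (\<Omega> - (\<lambda>m. m \<otimes>\<^bsub>M\<^esub> k) ` F))"
      using card_UN_le[OF K'(1), of "\<lambda>k. \<Omega> - (\<lambda>m. m \<otimes>\<^bsub>M\<^esub> k) ` F"] by presburger
    also have "\<dots> = card K' * card (\<Omega> - F)" using part by simp
    finally have "Suc q * card (\<Omega> - E) \<le> r * card (\<Omega> - F)"
      unfolding r_def by (metis mult.assoc mult_le_mono2)
    also have "\<dots> < card F"
      using F(3) \<Omega>F by (simp add: \<Omega>_def[symmetric] algebra_simps)
    also have "\<dots> \<le> card \<Omega>" using \<Omega>F by simp
    also have "\<dots> = card E + card (\<Omega> - E)"
      using EO fin by (simp add: card_Diff_subset card_mono finite_subset)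
    finally show ?thesis by simp
  qed
  ultimately show ?thesis by blast
qed

theorem corollary5p12:
  fixes M :: "('m, 'k) monoid_scheme"
  assumes "monoid_cancel M"
    and "left_amenable M \<or> right_amenable M"
  shows "surjunctive TYPE('a) M"
proof (rule surjunctive_if_models[where 'w = 'm])
  interpret monoid_cancel M by fact
  show "monoid M" by unfold_locales
  show "\<exists>(\<Omega> :: 'm set) E \<phi>. translation_model M K \<Omega> E \<phi> \<and> q * card (\<Omega> - E) < card E"
    if "finite K" "K \<subseteq> carrier M" for K q
    using assms(2) left_amenable_model[OF assms(1) _ that] right_amenable_model[OF assms(1) _ that]
    by blast
qed

end
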